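(* Let $\mathbb{K}$ be a field of characteristic zero, let $X$ and $Y$ be linear spaces over $\mathbb{K}$, and let $\alpha,\beta,\gamma\in\mathbb{K}$. There exists a non-zero bi-additive mapping $A\colon X\times Y\to \mathbb{K}$ satisfying \[ A(\alpha x,\beta y)=\gamma A(x,y)\qquad (x\in X,\ y\in Y) \] if and only if $\gamma$ can be written as the product of algebraically conjugated elements to $\alpha$ and $\beta$ over $\mathbb{Q}$, respectively.
   Context: A mapping $A\colon X\times Y\to\mathbb{K}$ is bi-additive if it is additive in each of its two variables separately. That $\gamma$ can be written as the product of algebraically conjugated elements to $\alpha$ and $\beta$ over $\mathbb{Q}$, respectively, means that $\gamma=\delta_1(\alpha)\delta_2(\beta)$, where $\delta_1\colon\mathbb{Q}(\alpha)\to\mathbb{K}$ and $\delta_2\colon\mathbb{Q}(\beta)\to\mathbb{K}$ are injective homomorphisms.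
   Formalization: X and Y are assumed non-zero, and the conjugates δ1(α), δ2(β) are taken in an arbitrary algebraically closed extension of K rather than in K itself; the claim as written fails for X = 0 and for K = Q(a) with a³ = a + 1. *)

theory Defs
  imports Complex_Main "HOL-Computational_Algebra.Polynomial"
begin

definition biadditive ::
  "('x::ab_group_add \<Rightarrow> 'y::ab_group_add \<Rightarrow> 'k::ab_group_add) \<Rightarrow> bool" where
  "biadditive A \<longleftrightarrow> (\<forall>y. additive (\<lambda>x. A x y)) \<and> (\<forall>x. additive (\<lambda>y. A x y))"

definition is_subfield :: "'a::field set \<Rightarrow> bool" where
  "is_subfield F \<longleftrightarrow> 0 \<in> F \<and> 1 \<in> F \<and> (\<forall>x\<in>F. inverse x \<in> F) \<and>
     (\<forall>x\<in>F. \<forall>y\<in>F. x - y \<in> F \<and> x * y \<in> F)"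

text \<open>In characteristic zero every subfield contains the prime field of rational numbers,
  so the smallest subfield containing \<open>a\<close> is the simple extension of the rationals by \<open>a\<close>.\<close>

definition rat_adjoin :: "'a::field_char_0 \<Rightarrow> 'a set" where
  "rat_adjoin a = is_subfield hull {a}"

text \<open>Only the values of \<open>h\<close> on \<open>F\<close> matter.\<close>

definition field_embedding_on :: "'a::field set \<Rightarrow> ('a \<Rightarrow> 'b::field) \<Rightarrow> bool" where
  "field_embedding_on F h \<longleftrightarrow> h 1 = 1 \<and> inj_on h F \<and>
     (\<forall>x\<in>F. \<forall>y\<in>F. h (x + y) = h x + h y \<and> h (x * y) = h x * h y)"

text \<open>Here \<open>\<iota>\<close> embeds the base field into a field in which the conjugates are taken; for
  conjugates in the base field itself, \<open>\<iota>\<close> is the identity. A larger field is needed if the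
  base field is not algebraically closed. For example, let \<open>a\<close> be the real root of
  \<open>X^3 - X - 1\<close>, let \<open>s2\<close>, \<open>s3\<close> be the two non-real embeddings of the field \<open>K\<close> generated
  by \<open>a\<close>, and let \<open>A x y = s2 x * s3 y + s3 x * s2 y\<close>. Then \<open>A\<close> is a bi-additive map
  into \<open>K\<close> with \<open>A 1 1 = 2\<close> and \<open>A (a * x) (a * y) = (1 / a) * A x y\<close>, but the only
  embedding of \<open>K\<close> into itself is the identity, and \<open>1 / a\<close> differs from \<open>a * a\<close>.\<close>

definition product_of_conjugates ::
  "('k::field_char_0 \<Rightarrow> 'l::field) \<Rightarrow> 'k \<Rightarrow> 'k \<Rightarrow> 'k \<Rightarrow> bool" where
  "product_of_conjugates \<iota> \<alpha> \<beta> \<gamma> \<longleftrightarrow>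
     (\<exists>\<delta>1 \<delta>2. field_embedding_on (rat_adjoin \<alpha>) \<delta>1 \<and> field_embedding_on (rat_adjoin \<beta>) \<delta>2 \<and>
        \<iota> \<gamma> = \<delta>1 \<alpha> * \<delta>2 \<beta>)"

end

theory Submission
  imports Defs
begin

text \<open>
  The link between the two sides is that an embedding \<open>\<delta>\<close> of \<open>\<rat>(\<alpha>)\<close> with \<open>\<delta> \<alpha> = \<sigma>\<close> is the
  same thing as a non-zero additive function \<open>f\<close> on a vector space with
  \<open>f (\<alpha> x) = \<sigma> f x\<close>. Given \<open>f\<close>, the scalars \<open>c\<close> for which \<open>f (c x) = d f x\<close> for some \<open>d\<close>
  form a subfield containing \<open>\<alpha>\<close>, and \<open>c \<mapsto> d\<close> is the embedding
  (\<open>embedding_of_eigenfunction\<close>). Given \<open>\<delta>\<close>, a coordinate functional of the space over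
  \<open>\<rat>(\<alpha>)\<close>, composed with \<open>\<delta>\<close>, is such an \<open>f\<close> (\<open>semilinear_functional_exists\<close>).

  If \<open>\<gamma>\<close> is a product of conjugates, take eigenfunctions \<open>f\<close> on \<open>X\<close> and \<open>g\<close> on \<open>Y\<close>. Then
  \<open>f x g y\<close> satisfies the equation, but its values lie in the algebraically closed
  field \<open>L\<close> that contains the base field \<open>K\<close>; a \<open>K\<close>-linear
  projection of \<open>L\<close> onto \<open>K\<close> brings them back without disturbing the factor \<open>\<gamma>\<close>.

  Conversely, let \<open>A\<close> be a solution. If \<open>\<beta>\<close> is algebraic and not zero, the operator
  \<open>A \<mapsto> A(\<cdot>, \<beta> \<cdot>)\<close> is annihilated by a non-zero polynomial and preserves the space of
  \<open>L\<close>-valued solutions. As \<open>L\<close> is algebraically closed, this space contains an eigenvector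
  (\<open>eigenvector_of_annihilated_function\<close>), which is an eigenfunction in each variable
  separately and so yields both embeddings. The case of algebraic \<open>\<alpha>\<close> is symmetric. If both
  are transcendental, they may be mapped to any transcendental elements, and it only remains
  to write \<open>\<gamma> \<noteq> 0\<close> as a product of two of these (\<open>product_of_two_transcendentals\<close>). If
  \<open>\<alpha>\<close> or \<open>\<beta>\<close> is \<open>0\<close>, then \<open>\<gamma> = 0\<close>, and there is nothing to do.
\<close>

section \<open>Subfields and embeddings\<close>

lemma is_subfield_rat_adjoin: "is_subfield (rat_adjoin a)"
  unfolding rat_adjoin_def by (rule hull_in) (auto simp: is_subfield_def)

lemma in_rat_adjoin: "a \<in> rat_adjoin a"
  unfolding rat_adjoin_def by (simp add: hull_inc)

lemma is_subfieldD:
  assumes "is_subfield F"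
  shows "0 \<in> F" "1 \<in> F" "\<And>x. x \<in> F \<Longrightarrow> inverse x \<in> F" "\<And>x. x \<in> F \<Longrightarrow> - x \<in> F"
    "\<And>x y. x \<in> F \<Longrightarrow> y \<in> F \<Longrightarrow> x - y \<in> F" "\<And>x y. x \<in> F \<Longrightarrow> y \<in> F \<Longrightarrow> x + y \<in> F"
    "\<And>x y. x \<in> F \<Longrightarrow> y \<in> F \<Longrightarrow> x * y \<in> F"
proof -
  show *: "0 \<in> F" "1 \<in> F" "\<And>x. x \<in> F \<Longrightarrow> inverse x \<in> F"
    "\<And>x y. x \<in> F \<Longrightarrow> y \<in> F \<Longrightarrow> x - y \<in> F" "\<And>x y. x \<in> F \<Longrightarrow> y \<in> F \<Longrightarrow> x * y \<in> F"
    using assms by (auto simp: is_subfield_def)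
  show neg: "\<And>x. x \<in> F \<Longrightarrow> - x \<in> F"
    using *(1,4) by (metis diff_0)
  show "\<And>x y. x \<in> F \<Longrightarrow> y \<in> F \<Longrightarrow> x + y \<in> F"
    using *(4) neg by (metis diff_minus_eq_add)
qed

lemma field_embedding_UNIV_simps:
  assumes "field_embedding_on UNIV \<iota>"
  shows "\<iota> 0 = 0" "\<iota> 1 = 1" "\<iota> (x + y) = \<iota> x + \<iota> y" "\<iota> (x * y) = \<iota> x * \<iota> y"
    "\<iota> (- x) = - \<iota> x" "\<iota> (x - y) = \<iota> x - \<iota> y" "\<iota> x = 0 \<longleftrightarrow> x = 0" "\<iota> x = \<iota> y \<longleftrightarrow> x = y"
proof -
  have add: "additive \<iota>" using assms by (simp add: field_embedding_on_def additive_def)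
  show *: "\<iota> 0 = 0" "\<iota> 1 = 1" "\<iota> (x + y) = \<iota> x + \<iota> y" "\<iota> (x * y) = \<iota> x * \<iota> y"
    "\<iota> (- x) = - \<iota> x" "\<iota> (x - y) = \<iota> x - \<iota> y"
    using assms additive.zero[OF add] additive.minus[OF add] additive.diff[OF add]
    by (simp_all add: field_embedding_on_def)
  show "\<iota> x = \<iota> y \<longleftrightarrow> x = y" using assms by (auto simp: field_embedding_on_def dest: injD)
  show "\<iota> x = 0 \<longleftrightarrow> x = 0" using assms *(1) by (metis field_embedding_on_def injD)
qed

lemma field_embedding_on_subset:
  "field_embedding_on F h \<Longrightarrow> E \<subseteq> F \<Longrightarrow> field_embedding_on E h"
  unfolding field_embedding_on_def by (meson inj_on_subset subsetD)

lemma field_embedding_on_comp: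
  "field_embedding_on F h \<Longrightarrow> field_embedding_on UNIV \<iota> \<Longrightarrow> field_embedding_on F (\<lambda>x. \<iota> (h x))"
  unfolding field_embedding_on_def inj_on_def by simp

text \<open>
  Both kinds of embedding constructed below arise as a correspondence between elements of the
  two fields that respects the field operations. Such a correspondence is a subfield of the
  product ring in which neither coordinate can vanish alone, hence the graph of a bijection
  between subfields.
\<close>

lemma embedding_of_graph:
  fixes R :: "('k::field_char_0 \<times> 'l::field) set"
  assumes one: "(1, 1) \<in> R" 
    and diff: "\<And>c d c' d'. (c, d) \<in> R \<Longrightarrow> (c', d') \<in> R \<Longrightarrow> (c - c', d - d') \<in> R"
    and mult: "\<And>c d c' d'. (c, d) \<in> R \<Longrightarrow> (c', d') \<in> R \<Longrightarrow> (c * c', d * d') \<in> R"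
    and inv: "\<And>c d. (c, d) \<in> R \<Longrightarrow> (inverse c, inverse d) \<in> R"
    and zero: "\<And>c d. (c, d) \<in> R \<Longrightarrow> c = 0 \<longleftrightarrow> d = 0"
    and gen: "(\<alpha>, \<sigma>) \<in> R"
  shows "\<exists>\<delta>. field_embedding_on (rat_adjoin \<alpha>) \<delta> \<and> \<delta> \<alpha> = \<sigma>"
proof -
  have uniq: "d = d'" if "(c, d) \<in> R" "(c, d') \<in> R" for c d d'
    using zero[OF diff[OF that]] by simp
  have inj: "c = c'" if "(c, d) \<in> R" "(c', d) \<in> R" for c c' d
    using zero[OF diff[OF that]] by simp
  define \<delta> where "\<delta> c = (THE d. (c, d) \<in> R)" for c
  have \<delta>eq: "\<delta> c = d" if "(c, d) \<in> R" for c d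
    unfolding \<delta>_def using that uniq by blast
  have "is_subfield (Domain R)"
    unfolding is_subfield_def using one diff[OF one one] diff mult inv
    by (auto simp: Domain_iff) blast+
  then have "rat_adjoin \<alpha> \<subseteq> Domain R"
    unfolding rat_adjoin_def using gen by (intro hull_minimal) auto
  then have \<delta>R: "(c, \<delta> c) \<in> R" if "c \<in> rat_adjoin \<alpha>" for c
    using that \<delta>eq by blast
  have add: "(c + c', d + d') \<in> R" if "(c, d) \<in> R" "(c', d') \<in> R" for c d c' d'
    using diff[OF that(1) diff[OF diff[OF one one] that(2)]] by simp
  have "field_embedding_on (rat_adjoin \<alpha>) \<delta>"
    unfolding field_embedding_on_def inj_on_def
    using \<delta>R \<delta>eq one add mult inj by metis
  then show ?thesis using \<delta>eq[OF gen] by blast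
qed

section \<open>Embeddings and eigenfunctions\<close>

text \<open>
  Take a subspace over \<open>F\<close> maximal among those that do not contain \<open>x0\<close>. It is a complement of
  the line through \<open>x0\<close>, so every \<open>x\<close> has an \<open>x0\<close>-coordinate in \<open>F\<close>, to which \<open>\<delta>\<close> can be
  applied. The scalars of the vector space form the whole type while \<open>F\<close> is only a set, so
  the complement comes from Zorn's lemma and not from a basis.
\<close>

lemma semilinear_functional_exists:
  fixes sc :: "'k::field \<Rightarrow> 'x::ab_group_add \<Rightarrow> 'x" and \<delta> :: "'k \<Rightarrow> 'l::field"
  assumes vs: "vector_space sc" and F: "is_subfield F" and \<delta>: "field_embedding_on F \<delta>"
    and x0: "x0 \<noteq> 0"
  shows "\<exists>f. additive f \<and> f x0 = 1 \<and> (\<forall>c\<in>F. \<forall>x. f (sc c x) = \<delta> c * f x)"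
proof -
  interpret vector_space sc by fact
  note FD = is_subfieldD[OF F]
  define S where "S = {M. 0 \<in> M \<and> (\<forall>u\<in>M. \<forall>v\<in>M. u + v \<in> M) \<and>
    (\<forall>c\<in>F. \<forall>u\<in>M. sc c u \<in> M) \<and> x0 \<notin> M}"
  have "\<exists>M\<in>S. \<forall>N\<in>S. M \<subseteq> N \<longrightarrow> N = M"
  proof (rule subset_Zorn_nonempty)
    have "{0} \<in> S" using x0 by (auto simp: S_def)
    then show "S \<noteq> {}" by blast
  next
    fix C assume C: "C \<noteq> {}" "subset.chain S C"
    then have sub: "C \<subseteq> S" and lin: "\<And>U V. U \<in> C \<Longrightarrow> V \<in> C \<Longrightarrow> U \<subseteq> V \<or> V \<subseteq> U"
      by (auto simp: subset_chain_def)
    have "u + v \<in> \<Union>C" if uv: "u \<in> \<Union>C" "v \<in> \<Union>C" for u v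
    proof -
      obtain U V where UV: "U \<in> C" "u \<in> U" "V \<in> C" "v \<in> V" using uv by blast
      obtain W where "W \<in> C" "u \<in> W" "v \<in> W" using lin[OF UV(1,3)] UV by blast
      then show ?thesis using sub unfolding S_def by blast
    qed
    moreover have "sc c u \<in> \<Union>C" if "c \<in> F" "u \<in> \<Union>C" for c u
      using that sub unfolding S_def by blast
    moreover have "0 \<in> \<Union>C" "x0 \<notin> \<Union>C"
      using sub C(1) unfolding S_def by blast+
    ultimately show "\<Union>C \<in> S" unfolding S_def by blast
  qed
  then obtain M where M: "M \<in> S" and maxM: "\<And>N. N \<in> S \<Longrightarrow> M \<subseteq> N \<Longrightarrow> N = M" by blast
  have M0: "0 \<in> M" and Madd: "\<And>u v. u \<in> M \<Longrightarrow> v \<in> M \<Longrightarrow> u + v \<in> M"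
    and Msc: "\<And>c u. c \<in> F \<Longrightarrow> u \<in> M \<Longrightarrow> sc c u \<in> M" and Mx0: "x0 \<notin> M"
    using M by (auto simp: S_def)
  have Mneg: "- u \<in> M" if "u \<in> M" for u
    using Msc[OF FD(4)[OF FD(2)] that] by simp
  have Mdiff: "u - v \<in> M" if "u \<in> M" "v \<in> M" for u v
    using Madd[OF that(1) Mneg[OF that(2)]] by simp
  \<comment> \<open>If \<open>x \<notin> M\<close>, then \<open>M + F x\<close> contains \<open>x0\<close> by maximality; solve \<open>x0 = u + c x\<close> for \<open>x\<close>.\<close>
  have ex: "\<exists>c\<in>F. x - sc c x0 \<in> M" for x
  proof (cases "x \<in> M")
    case True
    then show ?thesis using FD(1) by (intro bexI[of _ 0]) auto
  next
    case False
    define N where "N = {u + sc c x |u c. u \<in> M \<and> c \<in> F}"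
    have MN: "M \<subseteq> N"
    proof
      fix u assume "u \<in> M"
      then have "u + sc 0 x \<in> N" unfolding N_def using FD(1) by blast
      then show "u \<in> N" by simp
    qed
    have "0 + sc 1 x \<in> N" unfolding N_def using M0 FD(2) by blast
    then have "N \<noteq> M" using False by auto
    then have "N \<notin> S" using maxM MN by blast
    moreover have "0 \<in> N" using MN M0 by blast
    moreover have "v + w \<in> N" if v: "v \<in> N" and w: "w \<in> N" for v w
    proof -
      obtain a c where "v = a + sc c x" "a \<in> M" "c \<in> F"
        using v unfolding N_def by blast
      moreover obtain b d where "w = b + sc d x" "b \<in> M" "d \<in> F"
        using w unfolding N_def by blast
      ultimately have "v + w = (a + b) + sc (c + d) x" "a + b \<in> M" "c + d \<in> F"
        using Madd FD(6) by (auto simp: scale_left_distrib)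
      then show ?thesis unfolding N_def by blast
    qed
    moreover have "sc c v \<in> N" if c: "c \<in> F" and v: "v \<in> N" for c v
    proof -
      obtain a d where "v = a + sc d x" "a \<in> M" "d \<in> F"
        using v unfolding N_def by blast
      then have "sc c v = sc c a + sc (c * d) x" "sc c a \<in> M" "c * d \<in> F"
        using Msc FD(7) c by (auto simp: scale_right_distrib)
      then show ?thesis unfolding N_def by blast
    qed
    ultimately have "x0 \<in> N" by (auto simp: S_def)
    then obtain u c where uc: "x0 = u + sc c x" "u \<in> M" "c \<in> F" unfolding N_def by blast
    have "c \<noteq> 0" using uc Mx0 by auto
    have "x - sc (inverse c) x0 = sc (- inverse c) u"
      using \<open>c \<noteq> 0\<close> by (simp add: uc(1) scale_right_distrib)
    moreover have "sc (- inverse c) u \<in> M"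
      by (rule Msc[OF FD(4)[OF FD(3)[OF uc(3)]] uc(2)])
    ultimately show ?thesis using FD(3)[OF uc(3)] by (intro bexI[of _ "inverse c"]) simp_all
  qed
  have uniq: "c = d" if "c \<in> F" "d \<in> F" "x - sc c x0 \<in> M" "x - sc d x0 \<in> M" for c d x
  proof (rule ccontr)
    assume "c \<noteq> d"
    have "(x - sc d x0) - (x - sc c x0) = sc (c - d) x0" by (simp add: scale_left_diff_distrib)
    then have "sc (c - d) x0 \<in> M" using Mdiff[OF that(4,3)] by simp
    then have "sc (inverse (c - d)) (sc (c - d) x0) \<in> M"
      by (rule Msc[OF FD(3)[OF FD(5)[OF that(1,2)]]])
    then show False using \<open>c \<noteq> d\<close> Mx0 by simp
  qed
  define k where "k x = (THE c. c \<in> F \<and> x - sc c x0 \<in> M)" for x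
  have keq: "k x = c" if "c \<in> F" "x - sc c x0 \<in> M" for x c
    unfolding k_def using uniq that by blast
  have k: "k x \<in> F" "x - sc (k x) x0 \<in> M" for x
    using ex[of x] keq by auto
  have kadd: "k (x + y) = k x + k y" for x y
  proof (rule keq)
    have "x + y - sc (k x + k y) x0 = (x - sc (k x) x0) + (y - sc (k y) x0)"
      by (simp add: scale_left_distrib)
    then show "x + y - sc (k x + k y) x0 \<in> M" using Madd[OF k(2)[of x] k(2)[of y]] by metis
  qed (rule FD(6)[OF k(1) k(1)])
  have ksc: "k (sc c x) = c * k x" if "c \<in> F" for c x
  proof (rule keq)
    have "sc c x - sc (c * k x) x0 = sc c (x - sc (k x) x0)"
      by (simp add: scale_right_diff_distrib)
    then show "sc c x - sc (c * k x) x0 \<in> M" using Msc[OF that k(2)] by simp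
  qed (rule FD(7)[OF that k(1)])
  have k1: "k x0 = 1" by (rule keq) (simp_all add: FD(2) M0)
  have "additive (\<lambda>x. \<delta> (k x))"
    using \<delta> k by (simp add: additive_def kadd field_embedding_on_def)
  moreover have "\<delta> (k x0) = 1" using \<delta> by (simp add: k1 field_embedding_on_def)
  moreover have "\<delta> (k (sc c x)) = \<delta> c * \<delta> (k x)" if "c \<in> F" for c x
    using \<delta> k that by (simp add: ksc field_embedding_on_def)
  ultimately show ?thesis by blast
qed

text \<open>
  The pairs \<open>(c, d)\<close> with \<open>f (c x) = d f x\<close> for all \<open>x\<close> form a graph as in
  \<open>embedding_of_graph\<close>. Compatibility with inverses holds because \<open>x\<close> may be replaced by
  \<open>c\<^sup>-\<^sup>1 x\<close>. So minimal polynomials never have to be considered.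
\<close>

lemma embedding_of_eigenfunction:
  fixes sc :: "'k::field_char_0 \<Rightarrow> 'x::ab_group_add \<Rightarrow> 'x" and f :: "'x \<Rightarrow> 'l::field"
  assumes vs: "vector_space sc" and add: "additive f" and nz: "f x0 \<noteq> 0"
    and eig: "\<And>x. f (sc \<alpha> x) = \<sigma> * f x"
  shows "\<exists>\<delta>. field_embedding_on (rat_adjoin \<alpha>) \<delta> \<and> \<delta> \<alpha> = \<sigma>"
proof -
  interpret vector_space sc by fact
  interpret additive f by fact
  define R where "R = {(c, d). \<forall>x. f (sc c x) = d * f x}"
  have R: "(c, d) \<in> R \<longleftrightarrow> (\<forall>x. f (sc c x) = d * f x)" for c d
    by (simp add: R_def)
  have zero': "c = 0 \<longleftrightarrow> d = 0" if "(c, d) \<in> R" for c d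
  proof
    assume "c = 0"
    then have "d * f x0 = 0" using that by (metis R scale_zero_left zero)
    then show "d = 0" using nz by simp
  next
    assume "d = 0"
    then have "f (sc c (sc (inverse c) x0)) = 0" using that by (simp add: R del: scale_scale)
    then show "c = 0" using nz by (cases "c = 0") auto
  qed
  show ?thesis
  proof (rule embedding_of_graph[of R])
    show "(inverse c, inverse d) \<in> R" if cd: "(c, d) \<in> R" for c d
    proof (cases "c = 0")
      case True
      then show ?thesis using zero'[OF cd] cd by simp
    next
      case False
      then have "d \<noteq> 0" using zero'[OF cd] by simp
      have "f (sc (inverse c) x) = inverse d * f x" for x
      proof -
        have "f x = f (sc c (sc (inverse c) x))" using False by simp
        also have "\<dots> = d * f (sc (inverse c) x)" using cd unfolding R by blast
        finally show ?thesis using \<open>d \<noteq> 0\<close> by simp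
      qed
      then show ?thesis by (simp add: R)
    qed
    show "(c * c', d * d') \<in> R" if cd: "(c, d) \<in> R" "(c', d') \<in> R" for c d c' d'
    proof -
      have "f (sc (c * c') x) = d * d' * f x" for x
        using cd unfolding R by (metis scale_scale mult.assoc)
      then show ?thesis by (simp add: R)
    qed
  qed (use eig zero' in \<open>auto simp: R scale_left_diff_distrib diff left_diff_distrib\<close>)
qed

section \<open>Embeddings that move a transcendental element\<close>

lemma map_poly_of_int_mult:
  "map_poly of_int (p * q) = (map_poly of_int p * map_poly of_int q :: 'a::comm_ring_1 poly)"
  by (rule poly_eqI) (simp add: coeff_map_poly coeff_mult)

lemma map_poly_of_int_diff:
  "map_poly of_int (p - q) = (map_poly of_int p - map_poly of_int q :: 'a::comm_ring_1 poly)"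
  by (rule poly_eqI) (simp add: coeff_map_poly)

lemma transcendental_eval_eq_0_iff:
  fixes \<alpha> :: "'k::field_char_0"
  assumes "\<not> algebraic \<alpha>"
  shows "poly (map_poly of_int p) \<alpha> = 0 \<longleftrightarrow> p = 0"
proof
  assume "poly (map_poly of_int p) \<alpha> = 0"
  then have "map_poly of_int p = (0 :: 'k poly)"
    using assms algebraicI[of "map_poly of_int p" \<alpha>] by (auto simp: coeff_map_poly)
  then show "p = 0" by (simp add: map_poly_eq_0_iff)
qed simp

text \<open>
  Both fields are copies of the field of rational functions: the graph consists of the values
  of each rational function at \<open>\<alpha>\<close> and at \<open>\<sigma>\<close>. Denominators with integer coefficients
  suffice, and transcendence guarantees that they do not vanish.
\<close>

lemma embedding_of_transcendental:
  fixes \<alpha> :: "'k::field_char_0" and \<sigma> :: "'l::field_char_0"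
  assumes \<alpha>: "\<not> algebraic \<alpha>" and \<sigma>: "\<not> algebraic \<sigma>"
  shows "\<exists>\<delta>. field_embedding_on (rat_adjoin \<alpha>) \<delta> \<and> \<delta> \<alpha> = \<sigma>"
proof -
  let ?ek = "\<lambda>p. poly (map_poly of_int p) \<alpha>"
  let ?el = "\<lambda>p. poly (map_poly of_int p) \<sigma>"
  note nz = transcendental_eval_eq_0_iff[OF \<alpha>] transcendental_eval_eq_0_iff[OF \<sigma>]
  note hom = map_poly_of_int_mult map_poly_of_int_diff
  define R where "R = {(?ek p / ?ek q, ?el p / ?el q) |p q. q \<noteq> 0}"
  have RI: "(?ek p / ?ek q, ?el p / ?el q) \<in> R" if "q \<noteq> 0" for p q
    unfolding R_def using that by blast
  show ?thesis
  proof (rule embedding_of_graph[of R])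
    show "(1, 1) \<in> R" using RI[of 1 1] by simp
    show "(\<alpha>, \<sigma>) \<in> R" using RI[of 1 "[:0, 1:]"] by (simp add: map_poly_pCons)
  next
    fix c d c' d' assume "(c, d) \<in> R" "(c', d') \<in> R"
    then obtain p q p' q' where *: "c = ?ek p / ?ek q" "d = ?el p / ?el q" "q \<noteq> 0"
      "c' = ?ek p' / ?ek q'" "d' = ?el p' / ?el q'" "q' \<noteq> 0"
      unfolding R_def by blast
    show "(c - c', d - d') \<in> R"
      using RI[of "q * q'" "p * q' - p' * q"] * by (simp add: hom nz diff_frac_eq mult.commute)
    show "(c * c', d * d') \<in> R"
      using RI[of "q * q'" "p * p'"] * by (simp add: hom)
  next
    fix c d assume "(c, d) \<in> R"
    then obtain p q where *: "c = ?ek p / ?ek q" "d = ?el p / ?el q" "q \<noteq> 0"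
      unfolding R_def by blast
    show "c = 0 \<longleftrightarrow> d = 0" using * by (simp add: nz)
    show "(inverse c, inverse d) \<in> R"
    proof (cases "p = 0")
      case True
      then show ?thesis using * RI[of 1 0] by simp
    next
      case False
      then show ?thesis using * RI[of p q] by simp
    qed
  qed
qed

section \<open>Eigenvectors in an algebraically closed field\<close>

text \<open>
  The operator is precomposition with \<open>t\<close>, and the predicate \<open>P\<close> stands for a space of
  functions that it preserves; it is left abstract because the same argument is applied to
  additive and bi-additive functions, and again inside an eigenspace already found. If
  \<open>r\<close> is a root of \<open>p = (X - r) q\<close>, then the image of \<open>B\<close> under the operator minus \<open>r\<close> is
  either zero, so that \<open>B\<close> is an eigenvector, or a non-zero function annihilated by \<open>q\<close>.
\<close>

lemma eigenvector_of_annihilated_function: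
  fixes B :: "'i \<Rightarrow> 'l::alg_closed_field" and t :: "'i \<Rightarrow> 'i"
  assumes closed: "\<And>B r. P B \<Longrightarrow> P (\<lambda>z. B (t z) - r * B z)"
    and "p \<noteq> 0" "P B" "B w \<noteq> 0"
    and "\<And>z. (\<Sum>i\<le>degree p. coeff p i * B ((t ^^ i) z)) = 0"
  shows "\<exists>B' r. P B' \<and> (\<exists>z. B' z \<noteq> 0) \<and> poly p r = 0 \<and> (\<forall>z. B' (t z) = r * B' z)"
  using assms(2-)
proof (induction "degree p" arbitrary: p B w)
  case 0
  then have "coeff p 0 * B w = 0" by (metis (no_types, lifting) atMost_0 funpow_0
    sum.empty sum.insert finite.emptyI empty_iff add.right_neutral)
  moreover have "coeff p 0 \<noteq> 0" using 0 by (metis leading_coeff_0_iff)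
  ultimately show ?case using 0 by simp
next
  case (Suc n)
  obtain r where r: "poly p r = 0"
    using alg_closed_imp_poly_has_root[of p] Suc.hyps(2) by auto
  then obtain q where q: "p = [:- r, 1:] * q" by (auto simp: poly_eq_0_iff_dvd dvd_def)
  have q0: "q \<noteq> 0" using Suc.prems(1) q by auto
  have dq: "degree p = Suc (degree q)"
    unfolding q using q0 by (subst degree_mult_eq) auto
  define B' where "B' z = B (t z) - r * B z" for z
  have PB': "P B'" unfolding B'_def using closed Suc.prems(2) by simp
  show ?case
  proof (cases "\<forall>z. B' z = 0")
    case True
    then show ?thesis using r Suc.prems by (auto simp: B'_def)
  next
    case False
    then obtain z1 where "B' z1 \<noteq> 0" by blast
    moreover have "(\<Sum>i\<le>degree q. coeff q i * B' ((t ^^ i) z)) = 0" for z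
    proof -
      let ?g = "\<lambda>i. B ((t ^^ i) z)"
      have coeff_p: "coeff p i = (case i of 0 \<Rightarrow> 0 | Suc j \<Rightarrow> coeff q j) - r * coeff q i" for i
        unfolding q by (simp add: coeff_pCons)
      have "0 = (\<Sum>i\<le>degree p. coeff p i * ?g i)" using Suc.prems(4) by simp
      also have "\<dots> = (\<Sum>i\<le>Suc (degree q). (case i of 0 \<Rightarrow> 0 | Suc j \<Rightarrow> coeff q j) * ?g i)
          - r * (\<Sum>i\<le>Suc (degree q). coeff q i * ?g i)"
        unfolding dq
        by (simp add: coeff_p sum_subtractf[symmetric] sum_distrib_left algebra_simps
          del: sum.atMost_Suc)
      also have "(\<Sum>i\<le>Suc (degree q). coeff q i * ?g i) = (\<Sum>i\<le>degree q. coeff q i * ?g i)"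
        by (simp add: coeff_eq_0)
      also have "(\<Sum>i\<le>Suc (degree q). (case i of 0 \<Rightarrow> 0 | Suc j \<Rightarrow> coeff q j) * ?g i)
          = (\<Sum>i\<le>degree q. coeff q i * ?g (Suc i))"
        by (subst sum.atMost_Suc_shift) simp
      finally show ?thesis
        by (simp add: B'_def sum_subtractf[symmetric] sum_distrib_left algebra_simps)
    qed
    ultimately obtain B'' s where "P B''" "\<exists>z. B'' z \<noteq> 0" "poly q s = 0"
        "\<forall>z. B'' (t z) = s * B'' z"
      using Suc.hyps(1)[of q B' z1] q0 PB' dq Suc.hyps(2) by auto
    then show ?thesis by (auto simp: q)
  qed
qed

lemma additive_scale_int:
  fixes sc :: "'k::field \<Rightarrow> 'y::ab_group_add \<Rightarrow> 'y" and f :: "'y \<Rightarrow> 'l::field"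
  assumes vs: "vector_space sc" and \<iota>: "field_embedding_on UNIV \<iota>" and add: "additive f"
    and "c \<in> \<int>"
  shows "f (sc c y) = \<iota> c * f y"
proof -
  interpret vector_space sc by fact
  interpret additive f by fact
  note \<iota>s = field_embedding_UNIV_simps[OF \<iota>]
  obtain n where n: "c = of_int n" using assms(4) by (auto elim: Ints_cases)
  have "f (sc (of_int n) y) = \<iota> (of_int n) * f y"
    by (induction n rule: int_induct[of _ 0])
      (simp_all add: \<iota>s zero add diff scale_left_distrib scale_left_diff_distrib algebra_simps)
  then show ?thesis by (simp add: n)
qed

text \<open>
  An additive function commutes with integer scalars only, and this is why a polynomial
  relation with integer coefficients for \<open>\<beta>\<close> passes to the operator of multiplying the
  argument by \<open>\<beta>\<close>.
\<close>

lemma additive_annihilated: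
  fixes sc :: "'k::field_char_0 \<Rightarrow> 'y::ab_group_add \<Rightarrow> 'y" and f :: "'y \<Rightarrow> 'l::field"
  assumes vs: "vector_space sc" and \<iota>: "field_embedding_on UNIV \<iota>" and add: "additive f"
    and p: "\<And>i. coeff p i \<in> \<int>" "poly p \<beta> = 0"
  shows "(\<Sum>i\<le>degree (map_poly \<iota> p). coeff (map_poly \<iota> p) i * f ((sc \<beta> ^^ i) y)) = 0"
proof -
  interpret vector_space sc by fact
  note \<iota>s = field_embedding_UNIV_simps[OF \<iota>]
  have pow: "(sc \<beta> ^^ i) y = sc (\<beta> ^ i) y" for i by (induction i) auto
  have "degree (map_poly \<iota> p) = degree p" by (rule degree_map_poly) (simp add: \<iota>s)
  then have "(\<Sum>i\<le>degree (map_poly \<iota> p). coeff (map_poly \<iota> p) i * f ((sc \<beta> ^^ i) y))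
      = (\<Sum>i\<le>degree p. f (sc (coeff p i) (sc (\<beta> ^ i) y)))"
    by (simp add: coeff_map_poly \<iota>s pow additive_scale_int[OF vs \<iota> add p(1)] del: scale_scale)
  also have "\<dots> = f (sc (poly p \<beta>) y)"
    by (simp add: poly_altdef scale_sum_left additive.sum[OF add])
  also have "\<dots> = 0" using p(2) additive.zero[OF add] by simp
  finally show ?thesis .
qed

section \<open>Products of transcendental elements\<close>

text \<open>
  Suppose that \<open>\<gamma>\<close> and \<open>\<tau> = \<gamma> / \<alpha>\<close> are both algebraic. For each \<open>n\<close> there is an additive
  \<open>f\<close> that turns multiplication by \<open>\<alpha>\<close> into multiplication by \<open>\<alpha> + n\<close>. Multiplications by
  \<open>\<gamma>\<close> and \<open>\<tau>\<close> commute, so \<open>f\<close> can be replaced by a common eigenfunction, with eigenvalues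
  \<open>g\<close> and \<open>h\<close> among the roots of two fixed polynomials. Since \<open>\<gamma> = \<alpha> \<tau>\<close>, this gives
  \<open>\<iota> (\<alpha> + n) = g / h\<close>, which has only finitely many values.
\<close>

lemma algebraic_divide_transcendental:
  fixes \<alpha> \<gamma> :: "'k::field_char_0" and \<iota> :: "'k \<Rightarrow> 'l::alg_closed_field"
  assumes \<iota>: "field_embedding_on UNIV \<iota>"
    and \<alpha>: "\<not> algebraic \<alpha>" and \<gamma>: "algebraic \<gamma>" "\<gamma> \<noteq> 0"
  shows "\<not> algebraic (\<gamma> / \<alpha>)"
proof
  define \<tau> where "\<tau> = \<gamma> / \<alpha>"
  assume "algebraic (\<gamma> / \<alpha>)"
  then obtain q where q: "\<And>i. coeff q i \<in> \<int>" "q \<noteq> 0" "poly q \<tau> = 0"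
    unfolding algebraic_def \<tau>_def by blast
  obtain p where p: "\<And>i. coeff p i \<in> \<int>" "p \<noteq> 0" "poly p \<gamma> = 0"
    using \<gamma>(1) unfolding algebraic_def by blast
  note \<iota>s = field_embedding_UNIV_simps[OF \<iota>]
  have \<alpha>0: "\<alpha> \<noteq> 0" using \<alpha> by auto
  have \<tau>0: "\<tau> \<noteq> 0" using \<alpha>0 \<gamma>(2) by (simp add: \<tau>_def)
  have vs: "vector_space ((*) :: 'k \<Rightarrow> 'k \<Rightarrow> 'k)"
    by unfold_locales (simp_all add: algebra_simps)
  let ?p = "map_poly \<iota> p" and ?q = "map_poly \<iota> q"
  have nz: "?p \<noteq> 0" "?q \<noteq> 0" using p(2) q(2) by (simp_all add: map_poly_eq_0_iff \<iota>s)
  have "\<iota> (\<alpha> + of_nat n) \<in> (\<lambda>(g, h). g / h) ` ({g. poly ?p g = 0} \<times> {h. poly ?q h = 0})" for n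
  proof -
    define s where "s = \<iota> (\<alpha> + of_nat n)"
    have "\<not> algebraic (\<alpha> + of_nat n)"
    proof
      assume "algebraic (\<alpha> + of_nat n)"
      then have "algebraic \<alpha>"
        by (rule algebraic_root[where p = "[:of_nat n, 1:]"])
          (auto simp: coeff_pCons split: nat.splits)
      with \<alpha> show False by blast
    qed
    then obtain \<delta> :: "'k \<Rightarrow> 'k" where \<delta>: "field_embedding_on (rat_adjoin \<alpha>) \<delta>" "\<delta> \<alpha> = \<alpha> + of_nat n"
      using embedding_of_transcendental[OF \<alpha>] by blast
    obtain f where f: "additive f" "f (1::'k) = 1" "\<And>x. f (\<alpha> * x) = (\<alpha> + of_nat n) * f x"
      using semilinear_functional_exists[OF vs is_subfield_rat_adjoin \<delta>(1), of 1]
        \<delta>(2) in_rat_adjoin by force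
    define P where "P F \<longleftrightarrow> additive F \<and> (\<forall>x. F (\<alpha> * x) = s * F x)" for F :: "'k \<Rightarrow> 'l"
    have Pf: "P (\<lambda>x. \<iota> (f x))"
      using f by (simp add: P_def additive_def s_def \<iota>s)
    have closed: "P (\<lambda>x. F (c * x) - r * F x)" if "P F" for F c r
    proof -
      have "F (c * (\<alpha> * x)) = s * F (c * x)" for x
        using that by (metis P_def mult.left_commute)
      then show ?thesis using that by (simp add: P_def additive_def algebra_simps del: mult.assoc)
    qed
    have ann: "(\<Sum>i\<le>degree ?p. coeff ?p i * F (((*) \<gamma> ^^ i) x)) = 0"
      "(\<Sum>i\<le>degree ?q. coeff ?q i * F (((*) \<tau> ^^ i) x)) = 0" if "P F" for F x
      using additive_annihilated[OF vs \<iota> _ p(1,3)] additive_annihilated[OF vs \<iota> _ q(1,3)] that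
      by (auto simp: P_def)
    have "\<exists>F g. P F \<and> (\<exists>z. F z \<noteq> 0) \<and> poly ?p g = 0 \<and> (\<forall>x. F (\<gamma> * x) = g * F x)"
      by (rule eigenvector_of_annihilated_function[where w = 1 and B = "\<lambda>x. \<iota> (f x)"])
        (use closed nz Pf ann[OF Pf] f in \<open>auto simp: \<iota>s\<close>)
    then obtain F g z where F: "P F" "F z \<noteq> 0" "poly ?p g = 0" "\<And>x. F (\<gamma> * x) = g * F x"
      by blast
    have "\<exists>G h. (P G \<and> (\<forall>x. G (\<gamma> * x) = g * G x)) \<and> (\<exists>z. G z \<noteq> 0) \<and> poly ?q h = 0 \<and>
        (\<forall>x. G (\<tau> * x) = h * G x)"
    proof (rule eigenvector_of_annihilated_function[where w = z and B = F])
      fix B r assume B: "P B \<and> (\<forall>x. B (\<gamma> * x) = g * B x)"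
      then have "B (\<tau> * (\<gamma> * x)) = g * B (\<tau> * x)" for x by (metis mult.left_commute)
      with B show "P (\<lambda>x. B (\<tau> * x) - r * B x) \<and>
          (\<forall>x. B (\<tau> * (\<gamma> * x)) - r * B (\<gamma> * x) = g * (B (\<tau> * x) - r * B x))"
        using closed[of B \<tau> r] by (simp add: right_diff_distrib mult.left_commute[of _ g] mult.left_commute[of r])
    qed (use nz F ann[OF F(1)] in auto)
    then obtain G h z' where G: "P G" "\<And>x. G (\<gamma> * x) = g * G x" "G z' \<noteq> 0" "poly ?q h = 0"
        "\<And>x. G (\<tau> * x) = h * G x"
      by blast
    have "h \<noteq> 0" using G(3) G(5)[of "z' / \<tau>"] \<tau>0 by auto
    have "g * G z' = G (\<alpha> * (\<tau> * z'))" using G(2) \<alpha>0 by (simp add: \<tau>_def)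
    also have "\<dots> = s * (h * G z')" using G(1,5) by (simp add: P_def)
    finally have "s = g / h" using G(3) \<open>h \<noteq> 0\<close> by (simp add: field_simps)
    with F(3) G(4) show ?thesis by (auto simp: s_def)
  qed
  then have "range (\<lambda>n. \<iota> (\<alpha> + of_nat n))
      \<subseteq> (\<lambda>(g, h). g / h) ` ({g. poly ?p g = 0} \<times> {h. poly ?q h = 0})" by blast
  moreover have "finite \<dots>" using nz by (auto simp: poly_roots_finite)
  moreover have "inj (\<lambda>n. \<iota> (\<alpha> + of_nat n))" by (auto simp: inj_def \<iota>s)
  ultimately show False using finite_subset finite_imageD infinite_UNIV_nat by metis
qed

text \<open>
  The factors are \<open>\<alpha>\<close> and \<open>\<gamma> / \<alpha>\<close> for algebraic \<open>\<gamma>\<close>, and \<open>\<gamma>\<^sup>2\<close> and \<open>\<gamma>\<^sup>-\<^sup>1\<close> otherwise.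
\<close>

lemma product_of_two_transcendentals:
  fixes \<alpha> \<gamma> :: "'k::field_char_0" and \<iota> :: "'k \<Rightarrow> 'l::alg_closed_field"
  assumes \<iota>: "field_embedding_on UNIV \<iota>" and \<alpha>: "\<not> algebraic \<alpha>" and \<gamma>: "\<gamma> \<noteq> 0"
  shows "\<exists>\<sigma> \<tau>. \<not> algebraic \<sigma> \<and> \<not> algebraic \<tau> \<and> \<gamma> = \<sigma> * \<tau>"
proof (cases "algebraic \<gamma>")
  case True
  have "\<alpha> \<noteq> 0" using \<alpha> by auto
  then show ?thesis using algebraic_divide_transcendental[OF \<iota> \<alpha> True \<gamma>] \<alpha>
    by (intro exI[of _ \<alpha>] exI[of _ "\<gamma> / \<alpha>"]) auto
next
  case False
  have "\<not> algebraic (\<gamma> ^ 2)"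
  proof
    assume "algebraic (\<gamma> ^ 2)"
    then have "algebraic \<gamma>"
      by (rule algebraic_root[where p = "monom 1 2"]) (auto simp: poly_monom degree_monom_eq)
    with False show False by blast
  qed
  moreover have "\<not> algebraic (inverse \<gamma>)"
    using False algebraic_inverse[of "inverse \<gamma>"] by auto
  moreover have "\<gamma> = \<gamma> ^ 2 * inverse \<gamma>" using \<gamma> by (simp add: power2_eq_square)
  ultimately show ?thesis by blast
qed

section \<open>Bi-additive maps and products of conjugates\<close>

text \<open>
  An eigenvector \<open>B\<close>, with eigenvalue \<open>r\<close>, for multiplying the second argument by \<open>\<beta>\<close> among
  the \<open>L\<close>-valued solutions is also one in the first argument: \<open>B(\<alpha> x, y) = \<gamma> r\<^sup>-\<^sup>1 B(x, y)\<close>.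
  Fixing either argument gives eigenfunctions for \<open>\<gamma> / r\<close> and \<open>r\<close>, and hence the embeddings.
  The same argument covers algebraic and transcendental \<open>\<alpha>\<close>.
\<close>

lemma embeddings_of_biadditive_if_algebraic:
  fixes scaleX :: "'k::field_char_0 \<Rightarrow> 'x::ab_group_add \<Rightarrow> 'x"
    and scaleY :: "'k \<Rightarrow> 'y::ab_group_add \<Rightarrow> 'y" and \<iota> :: "'k \<Rightarrow> 'l::alg_closed_field"
    and A :: "'x \<Rightarrow> 'y \<Rightarrow> 'k"
  assumes vsX: "vector_space scaleX" and vsY: "vector_space scaleY"
    and \<iota>: "field_embedding_on UNIV \<iota>"
    and A: "biadditive A" "A x0 y0 \<noteq> 0" "\<And>x y. A (scaleX \<alpha> x) (scaleY \<beta> y) = \<gamma> * A x y"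
    and \<beta>: "algebraic \<beta>" "\<beta> \<noteq> 0"
  shows "\<exists>\<delta>1 \<delta>2. field_embedding_on (rat_adjoin \<alpha>) \<delta>1 \<and> field_embedding_on (rat_adjoin \<beta>) \<delta>2 \<and>
    \<iota> \<gamma> = \<delta>1 \<alpha> * \<delta>2 \<beta>"
proof -
  interpret Y: vector_space scaleY by fact
  note \<iota>s = field_embedding_UNIV_simps[OF \<iota>]
  obtain p where p: "\<And>i. coeff p i \<in> \<int>" "p \<noteq> 0" "poly p \<beta> = 0"
    using \<beta>(1) unfolding algebraic_def by blast
  define P :: "('x \<times> 'y \<Rightarrow> 'l) \<Rightarrow> bool" where
    "P B \<longleftrightarrow> (\<forall>y. additive (\<lambda>x. B (x, y))) \<and> (\<forall>x. additive (\<lambda>y. B (x, y))) \<and>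
       (\<forall>x y. B (scaleX \<alpha> x, scaleY \<beta> y) = \<iota> \<gamma> * B (x, y))" for B
  let ?t = "\<lambda>(x, y). (x, scaleY \<beta> y)"
  let ?A = "\<lambda>(x, y). \<iota> (A x y)"
  have PA: "P ?A"
    using A by (simp add: P_def biadditive_def additive_def \<iota>s)
  have pow: "(?t ^^ i) (x, y) = (x, (scaleY \<beta> ^^ i) y)" for i and x :: 'x and y
    by (induction i) auto
  have "\<exists>B r. P B \<and> (\<exists>z. B z \<noteq> 0) \<and> poly (map_poly \<iota> p) r = 0 \<and> (\<forall>z. B (?t z) = r * B z)"
  proof (rule eigenvector_of_annihilated_function[where w = "(x0, y0)" and B = ?A])
    show "P (\<lambda>z. B (?t z) - r * B z)" if "P B" for B r
      using that by (simp add: P_def additive_def Y.scale_right_distrib right_diff_distrib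
          mult.left_commute distrib_left del: Y.scale_scale)
    show "map_poly \<iota> p \<noteq> 0" using p(2) by (simp add: map_poly_eq_0_iff \<iota>s)
    show "(\<Sum>i\<le>degree (map_poly \<iota> p). coeff (map_poly \<iota> p) i * ?A ((?t ^^ i) z)) = 0" for z
    proof (cases z)
      case (Pair x y)
      have "additive (\<lambda>y. \<iota> (A x y))" using PA by (simp add: P_def)
      from additive_annihilated[OF vsY \<iota> this p(1,3), of y] show ?thesis
        by (simp add: Pair pow)
    qed
  qed (use PA A(2) in \<open>auto simp: \<iota>s\<close>)
  then obtain B r x1 y1 where B: "P B" "B (x1, y1) \<noteq> 0" "\<And>x y. B (x, scaleY \<beta> y) = r * B (x, y)"
    by auto
  have "r \<noteq> 0" using B(2) B(3)[of x1 "scaleY (inverse \<beta>) y1"] \<beta>(2) by auto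
  have eig: "B (scaleX \<alpha> x, y) = \<iota> \<gamma> / r * B (x, y)" for x y
  proof -
    have "r * B (scaleX \<alpha> x, y) = \<iota> \<gamma> * B (x, y)"
      using B(1,3) by (metis P_def)
    then show ?thesis using \<open>r \<noteq> 0\<close> by (simp add: field_simps)
  qed
  obtain \<delta>1 where "field_embedding_on (rat_adjoin \<alpha>) \<delta>1" "\<delta>1 \<alpha> = \<iota> \<gamma> / r"
    using embedding_of_eigenfunction[OF vsX, of "\<lambda>x. B (x, y1)" x1 \<alpha> "\<iota> \<gamma> / r"] B eig
    by (auto simp: P_def)
  moreover obtain \<delta>2 where "field_embedding_on (rat_adjoin \<beta>) \<delta>2" "\<delta>2 \<beta> = r"
    using embedding_of_eigenfunction[OF vsY, of "\<lambda>y. B (x1, y)" y1 \<beta> r] B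
    by (auto simp: P_def)
  ultimately show ?thesis using \<open>r \<noteq> 0\<close> by (intro exI[of _ \<delta>1] exI[of _ \<delta>2]) simp
qed

theorem theorem3:
  fixes scaleX :: "'k::field_char_0 \<Rightarrow> 'x::ab_group_add \<Rightarrow> 'x"
    and scaleY :: "'k \<Rightarrow> 'y::ab_group_add \<Rightarrow> 'y"
    and \<alpha> \<beta> \<gamma> :: 'k
    and \<iota> :: "'k \<Rightarrow> 'l::alg_closed_field"
  assumes "vector_space scaleX" and "vector_space scaleY"
    and "\<exists>x::'x. x \<noteq> 0" and "\<exists>y::'y. y \<noteq> 0"
    and "field_embedding_on UNIV \<iota>"
  shows "(\<exists>A :: 'x \<Rightarrow> 'y \<Rightarrow> 'k. biadditive A \<and> (\<exists>x y. A x y \<noteq> 0) \<and>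
            (\<forall>x y. A (scaleX \<alpha> x) (scaleY \<beta> y) = \<gamma> * A x y))
         \<longleftrightarrow> product_of_conjugates \<iota> \<alpha> \<beta> \<gamma>"
proof
  note vsX = assms(1) and vsY = assms(2) and \<iota> = assms(5)
  interpret X: vector_space scaleX by fact
  interpret Y: vector_space scaleY by fact
  note \<iota>s = field_embedding_UNIV_simps[OF \<iota>]
  assume "\<exists>A :: 'x \<Rightarrow> 'y \<Rightarrow> 'k. biadditive A \<and> (\<exists>x y. A x y \<noteq> 0) \<and>
            (\<forall>x y. A (scaleX \<alpha> x) (scaleY \<beta> y) = \<gamma> * A x y)"
  then obtain A :: "'x \<Rightarrow> 'y \<Rightarrow> 'k" and x0 y0 where A: "biadditive A" "A x0 y0 \<noteq> 0"
    "\<And>x y. A (scaleX \<alpha> x) (scaleY \<beta> y) = \<gamma> * A x y" by blast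
  have A0: "A 0 y = 0" "A x 0 = 0" for x y
    using A(1) additive.zero[of "\<lambda>x. A x y"] additive.zero[of "A x"]
    by (auto simp: biadditive_def)
  consider (zero) "\<alpha> = 0 \<or> \<beta> = 0" | (beta) "\<alpha> \<noteq> 0" "\<beta> \<noteq> 0" "algebraic \<beta>"
    | (alpha) "\<alpha> \<noteq> 0" "\<beta> \<noteq> 0" "algebraic \<alpha>"
    | (transc) "\<alpha> \<noteq> 0" "\<beta> \<noteq> 0" "\<not> algebraic \<alpha>" "\<not> algebraic \<beta>" by blast
  then show "product_of_conjugates \<iota> \<alpha> \<beta> \<gamma>"
  proof cases
    case zero
    then have "\<gamma> = 0" using A(2) A(3)[of x0 y0] A0 by auto
    then have "\<iota> \<gamma> = \<iota> \<alpha> * \<iota> \<beta>" using zero by (auto simp: \<iota>s)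
    then show ?thesis
      using field_embedding_on_subset[OF \<iota>] by (auto simp: product_of_conjugates_def)
  next
    case beta
    show ?thesis
      unfolding product_of_conjugates_def
      by (rule embeddings_of_biadditive_if_algebraic[where A = A, OF vsX vsY \<iota> A(1,2) A(3) beta(3,2)])
  next
    case alpha
    have "biadditive (\<lambda>y x. A x y)" using A(1) by (auto simp: biadditive_def)
    from embeddings_of_biadditive_if_algebraic[where A = "\<lambda>y x. A x y", OF vsY vsX \<iota> this A(2) A(3) alpha(3,1)]
    obtain \<delta>1 \<delta>2 where "field_embedding_on (rat_adjoin \<beta>) \<delta>1"
        "field_embedding_on (rat_adjoin \<alpha>) \<delta>2" "\<iota> \<gamma> = \<delta>1 \<beta> * \<delta>2 \<alpha>"
      by blast
    then show ?thesis unfolding product_of_conjugates_def by (metis mult.commute)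
  next
    case transc
    have "\<gamma> \<noteq> 0"
      using A(2) A(3)[of "scaleX (inverse \<alpha>) x0" "scaleY (inverse \<beta>) y0"] transc by auto
    then obtain \<sigma> \<tau> where st: "\<not> algebraic \<sigma>" "\<not> algebraic \<tau>" "\<gamma> = \<sigma> * \<tau>"
      using product_of_two_transcendentals[OF \<iota> transc(3)] by blast
    obtain \<delta>1 :: "'k \<Rightarrow> 'k" where \<delta>1: "field_embedding_on (rat_adjoin \<alpha>) \<delta>1" "\<delta>1 \<alpha> = \<sigma>"
      using embedding_of_transcendental[OF transc(3) st(1)] by blast
    obtain \<delta>2 :: "'k \<Rightarrow> 'k" where \<delta>2: "field_embedding_on (rat_adjoin \<beta>) \<delta>2" "\<delta>2 \<beta> = \<tau>"
      using embedding_of_transcendental[OF transc(4) st(2)] by blast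
    show ?thesis
      unfolding product_of_conjugates_def
      using field_embedding_on_comp[OF \<delta>1(1) \<iota>] field_embedding_on_comp[OF \<delta>2(1) \<iota>] st(3) \<delta>1(2) \<delta>2(2)
      by (intro exI[of _ "\<lambda>x. \<iota> (\<delta>1 x)"] exI[of _ "\<lambda>x. \<iota> (\<delta>2 x)"]) (simp add: \<iota>s)
  qed
next
  note vsX = assms(1) and vsY = assms(2) and \<iota> = assms(5)
  note \<iota>s = field_embedding_UNIV_simps[OF \<iota>]
  obtain x0 :: 'x and y0 :: 'y where xy0: "x0 \<noteq> 0" "y0 \<noteq> 0" using assms(3,4) by blast
  assume "product_of_conjugates \<iota> \<alpha> \<beta> \<gamma>"
  then obtain \<delta>1 \<delta>2 where \<delta>: "field_embedding_on (rat_adjoin \<alpha>) \<delta>1"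
    "field_embedding_on (rat_adjoin \<beta>) \<delta>2" "\<iota> \<gamma> = \<delta>1 \<alpha> * \<delta>2 \<beta>"
    unfolding product_of_conjugates_def by blast
  obtain f :: "'x \<Rightarrow> 'l" where f: "additive f" "f x0 = 1" "\<And>x. f (scaleX \<alpha> x) = \<delta>1 \<alpha> * f x"
    using semilinear_functional_exists[OF vsX is_subfield_rat_adjoin \<delta>(1) xy0(1)] in_rat_adjoin
    by blast
  obtain g :: "'y \<Rightarrow> 'l" where g: "additive g" "g y0 = 1" "\<And>y. g (scaleY \<beta> y) = \<delta>2 \<beta> * g y"
    using semilinear_functional_exists[OF vsY is_subfield_rat_adjoin \<delta>(2) xy0(2)] in_rat_adjoin
    by blast
  \<comment> \<open>The projection \<open>\<pi>\<close> is a coordinate functional of \<open>L\<close> as a vector space over all of \<open>K\<close>.\<close>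
  have vsL: "vector_space (\<lambda>k z. \<iota> k * z)"
    by unfold_locales (simp_all add: algebra_simps \<iota>s)
  have "field_embedding_on UNIV (\<lambda>k::'k. k)" "is_subfield (UNIV :: 'k set)"
    by (auto simp: field_embedding_on_def is_subfield_def)
  from semilinear_functional_exists[OF vsL this(2,1), of 1]
  obtain \<pi> :: "'l \<Rightarrow> 'k" where \<pi>: "additive \<pi>" "\<pi> 1 = 1" "\<And>k z. \<pi> (\<iota> k * z) = k * \<pi> z"
    by auto
  define A where "A x y = \<pi> (f x * g y)" for x y
  have "biadditive A"
    using f(1) g(1) \<pi>(1) by (simp add: A_def biadditive_def additive_def algebra_simps)
  moreover have "A x0 y0 \<noteq> 0" using f(2) g(2) \<pi>(2) by (simp add: A_def)
  moreover have "A (scaleX \<alpha> x) (scaleY \<beta> y) = \<gamma> * A x y" for x y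
  proof -
    have "f (scaleX \<alpha> x) * g (scaleY \<beta> y) = \<iota> \<gamma> * (f x * g y)"
      using f(3) g(3) \<delta>(3) by (simp add: algebra_simps)
    then show ?thesis using \<pi>(3) by (simp add: A_def)
  qed
  ultimately show "\<exists>A :: 'x \<Rightarrow> 'y \<Rightarrow> 'k. biadditive A \<and> (\<exists>x y. A x y \<noteq> 0) \<and>
            (\<forall>x y. A (scaleX \<alpha> x) (scaleY \<beta> y) = \<gamma> * A x y)"
    by blast
qed

end
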